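(* Let $p$ be an odd prime, $\lambda\in\mathbb{Z}_p$ and $x\in\mathbb{C}_p$. For every integer $n\ge1$, \[ (-1)^n\frac{Bl_n(x|\lambda)}{n!}=\sum_{m=1}^{n}\binom{n-1}{m-1}\frac{\hat{B}l_m(-x|\lambda)}{m!} \] and \[ (-1)^n\frac{\hat{B}l_n(x|\lambda)}{n!}=\sum_{m=1}^{n}\binom{n-1}{m-1}\frac{Bl_m(-x|\lambda)}{m!}. \]
   Context: For a continuous $f:\mathbb{Z}_p\to\mathbb{C}_p$, the fermionic $p$-adic integral is $\int_{\mathbb{Z}_p}f(y)\,d\mu_{-1}(y)=\lim_{N\to\infty}\sum_{a=0}^{p^N-1}f(a)(-1)^a$. $(z)_n=z(z-1)\cdots(z-n+1)$ is the falling factorial. The Boole polynomials $Bl_n(x|\lambda)$ are defined by \[ \sum_{n=0}^{\infty}Bl_n(x|\lambda)\frac{t^n}{n!}=\frac{1}{1+(1+t)^{\lambda}}(1+t)^x, \] with $(1+t)^a=\sum_{n\ge0}\binom{a}{n}t^n$. The Boole polynomials of the second kind are defined by \[ \hat{B}l_n(x|\lambda)=\frac12\int_{\mathbb{Z}_p}(-\lambda y+x)_n\,d\mu_{-1}(y)\quad (n\ge0). \] *)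

theory Defs
  imports "HOL-Analysis.Analysis" "HOL-Computational_Algebra.Formal_Power_Series"
begin

text \<open>
  The field of \<open>p\<close>-adic complex numbers is characterised, up to isometric isomorphism, as the
  completion of an algebraic closure of the completion of the rationals under the \<open>p\<close>-adic
  absolute value. The type class \<^class>\<open>real_normed_field\<close> is not usable here, since its norm is
  compatible with the real absolute value; instead the absolute value of \<open>z\<close> is \<open>dist z 0\<close>.
\<close>

definition padic_numbers :: "'a::{field_char_0,metric_space} set" where
  "padic_numbers = closure \<rat>"

definition padic_integers :: "'a::{field_char_0,metric_space} set" where
  "padic_integers = {z \<in> padic_numbers. dist z 0 \<le> 1}"

definition padic_algebraic :: "'a::{field_char_0,metric_space} set" where
  "padic_algebraic =
     {z. \<exists>P :: 'a poly. P \<noteq> 0 \<and> (\<forall>i. coeff P i \<in> padic_numbers) \<and> poly P z = 0}"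

text \<open>
  Completeness is part of the class \<^class>\<open>complete_space\<close>. The value at \<open>p\<close> determines a
  multiplicative ultrametric absolute value on the rationals, namely the \<open>p\<close>-adic one.
\<close>

definition is_padic_complex_field :: "nat \<Rightarrow> 'a::{field_char_0,complete_space} itself \<Rightarrow> bool" where
  "is_padic_complex_field p (_ :: 'a itself) \<longleftrightarrow>
     prime p \<and>
     (\<forall>u v :: 'a. dist u v = dist (u - v) 0) \<and>
     (\<forall>u v :: 'a. dist (u * v) 0 = dist u 0 * dist v 0) \<and>
     (\<forall>u v :: 'a. dist (u + v) 0 \<le> max (dist u 0) (dist v 0)) \<and>
     dist (of_nat p :: 'a) 0 = 1 / real p \<and>
     (\<forall>P :: 'a poly. degree P > 0 \<and> (\<forall>i. coeff P i \<in> padic_algebraic) \<longrightarrow>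
        (\<exists>z \<in> padic_algebraic. poly P z = 0)) \<and>
     closure (padic_algebraic :: 'a set) = UNIV"

definition fermionic_integral ::
  "nat \<Rightarrow> ('a::{field_char_0,metric_space} \<Rightarrow> 'a) \<Rightarrow> 'a" where
  "fermionic_integral p f = lim (\<lambda>N. \<Sum>a = 0..p ^ N - 1. f (of_nat a) * (-1) ^ a)"

definition falling_factorial :: "'a::comm_ring_1 \<Rightarrow> nat \<Rightarrow> 'a" where
  "falling_factorial z n = (\<Prod>i<n. z - of_nat i)"

text \<open>\<^term>\<open>fps_binomial a\<close> is the formal power series \<open>(1 + t)\<close> to the power \<open>a\<close>.\<close>

definition boole_poly :: "nat \<Rightarrow> 'a::field_char_0 \<Rightarrow> 'a \<Rightarrow> 'a" where
  "boole_poly n x l = fact n * fps_nth (1 / (1 + fps_binomial l) * fps_binomial x) n"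

definition boole_poly_2nd ::
  "nat \<Rightarrow> nat \<Rightarrow> 'a::{field_char_0,metric_space} \<Rightarrow> 'a \<Rightarrow> 'a" where
  "boole_poly_2nd p n x l =
     1 / 2 * fermionic_integral p (\<lambda>y. falling_factorial (- l * y + x) n)"

end

theory Submission imports Defs begin

unbundle no vec_syntax
unbundle fps_syntax

text \<open>
  Put \<open>F\<^sub>x = (1 + t)\<^sup>x / (1 + (1 + t)\<^sup>\<lambda>)\<close>, the generating function of \<open>Bl\<^sub>m(x) / m!\<close>.
  As \<open>p\<^sup>N\<close> is odd, the partial sums of the fermionic integral of \<open>(1 + t)\<close> to the power \<open>x - \<lambda>y\<close>
  are geometric and equal \<open>F\<^bsub>x+\<lambda>\<^esub> \<cdot> (1 + (1 + t)\<^bsup>-\<lambda>p^N\<^esup>)\<close>. Since \<open>p\<^sup>N \<rightarrow> 0\<close>, they converge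
  coefficientwise to \<open>2 F\<^bsub>x+\<lambda>\<^esub>\<close>, so \<open>F\<^bsub>x+\<lambda>\<^esub>\<close> generates the polynomials of the second kind.
  The substitution \<open>t \<mapsto> t / (1 - t)\<close> sends \<open>1 + t\<close> to \<open>1 / (1 - t)\<close>, hence \<open>F\<^sub>x(t)\<close> to
  \<open>F\<^bsub>\<lambda>-x\<^esub>(-t)\<close>, and the coefficient of \<open>t\<^sup>n\<close> in \<open>(t / (1 - t))\<^sup>m\<close> is the binomial
  coefficient in both identities.
\<close>

text \<open>The sorts do not link the metric to the field operations, so the limit laws come from
  the valuation axioms. The ultrametric bound is weakened to a sum so that real limits
  apply.\<close>

lemma padic_tendsto_add:
  fixes X Y :: "'b \<Rightarrow> 'a::{field_char_0,complete_space}"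
  assumes H: "is_padic_complex_field p TYPE('a)"
    and X: "(X \<longlongrightarrow> a) F" and Y: "(Y \<longlongrightarrow> b) F"
  shows "((\<lambda>i. X i + Y i) \<longlongrightarrow> a + b) F"
proof (rule metric_tendsto_imp_tendsto)
  show "((\<lambda>i. dist (X i) a + dist (Y i) b) \<longlongrightarrow> 0) F"
    using tendsto_add[OF tendsto_dist[OF X tendsto_const[of a]] tendsto_dist[OF Y tendsto_const[of b]]]
    by simp
  have "dist (X i + Y i) (a + b) \<le> dist (X i) a + dist (Y i) b" for i
  proof -
    have "dist (X i + Y i) (a + b) = dist ((X i - a) + (Y i - b)) 0"
      using H unfolding is_padic_complex_field_def by (metis add_diff_add)
    also have "\<dots> \<le> max (dist (X i - a) 0) (dist (Y i - b) 0)"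
      using H unfolding is_padic_complex_field_def by blast
    also have "\<dots> = max (dist (X i) a) (dist (Y i) b)"
      using H unfolding is_padic_complex_field_def by metis
    also have "\<dots> \<le> dist (X i) a + dist (Y i) b" by simp
    finally show ?thesis .
  qed
  then show "\<forall>\<^sub>F i in F. dist (X i + Y i) (a + b) \<le> dist (dist (X i) a + dist (Y i) b) 0"
    by (simp add: dist_real_def)
qed

lemma padic_tendsto_mult:
  fixes X Y :: "'b \<Rightarrow> 'a::{field_char_0,complete_space}"
  assumes H: "is_padic_complex_field p TYPE('a)"
    and X: "(X \<longlongrightarrow> a) F" and Y: "(Y \<longlongrightarrow> b) F"
  shows "((\<lambda>i. X i * Y i) \<longlongrightarrow> a * b) F"
proof (rule metric_tendsto_imp_tendsto)
  let ?e = "\<lambda>i. dist (X i) a * dist (Y i) 0 + dist a 0 * dist (Y i) b"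
  have "(?e \<longlongrightarrow> dist a a * dist b 0 + dist a 0 * dist b b) F"
    by (intro tendsto_intros X Y)
  then show "(?e \<longlongrightarrow> 0) F" by simp
  have "dist (X i * Y i) (a * b) \<le> ?e i" for i
  proof -
    have "X i * Y i - a * b = (X i - a) * Y i + a * (Y i - b)"
      by (simp add: algebra_simps)
    then have "dist (X i * Y i) (a * b) = dist ((X i - a) * Y i + a * (Y i - b)) 0"
      using H unfolding is_padic_complex_field_def by metis
    also have "\<dots> \<le> max (dist ((X i - a) * Y i) 0) (dist (a * (Y i - b)) 0)"
      using H unfolding is_padic_complex_field_def by blast
    also have "\<dots> = max (dist (X i) a * dist (Y i) 0) (dist a 0 * dist (Y i) b)"
      using H unfolding is_padic_complex_field_def by metis
    also have "\<dots> \<le> ?e i" by simp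
    finally show ?thesis .
  qed
  then show "\<forall>\<^sub>F i in F. dist (X i * Y i) (a * b) \<le> dist (?e i) 0"
    by (simp add: dist_real_def)
qed

lemma padic_tendsto_sum:
  fixes f :: "'c \<Rightarrow> 'b \<Rightarrow> 'a::{field_char_0,complete_space}"
  assumes H: "is_padic_complex_field p TYPE('a)"
    and "\<And>k. k \<in> K \<Longrightarrow> (f k \<longlongrightarrow> a k) F"
  shows "((\<lambda>i. \<Sum>k\<in>K. f k i) \<longlongrightarrow> (\<Sum>k\<in>K. a k)) F"
  using assms(2)
  by (induction K rule: infinite_finite_induct) (auto intro!: padic_tendsto_add[OF H])

text \<open>A binomial coefficient is a polynomial in its upper argument, so the sum and product
  laws suffice.\<close>

lemma padic_tendsto_gbinomial:
  fixes X :: "'b \<Rightarrow> 'a::{field_char_0,complete_space}"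
  assumes H: "is_padic_complex_field p TYPE('a)"
    and X: "(X \<longlongrightarrow> a) F"
  shows "((\<lambda>i. X i gchoose k) \<longlongrightarrow> a gchoose k) F"
proof -
  have "((\<lambda>i. \<Prod>j<k. X i - of_nat j) \<longlongrightarrow> (\<Prod>j<k. a - of_nat j)) F" for k
  proof (induction k)
    case (Suc k)
    have "((\<lambda>i. X i + - of_nat k) \<longlongrightarrow> a + - of_nat k) F"
      by (intro padic_tendsto_add[OF H] X tendsto_const)
    from padic_tendsto_mult[OF H Suc this] show ?case by simp
  qed simp
  from padic_tendsto_mult[OF H this tendsto_const[of "inverse (fact k)"]]
  show ?thesis by (simp add: gbinomial_prod_rev atLeast0LessThan divide_inverse)
qed

lemma padic_power_tendsto_0:
  assumes H: "is_padic_complex_field p TYPE('a::{field_char_0,complete_space})"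
  shows "(\<lambda>N. (of_nat (p ^ N) :: 'a)) \<longlonglongrightarrow> 0"
proof (rule metric_tendsto_imp_tendsto)
  have mult: "\<And>u v :: 'a. dist (u * v) 0 = dist u 0 * dist v 0"
    and p: "dist (of_nat p :: 'a) 0 = 1 / real p" and "prime p"
    using H unfolding is_padic_complex_field_def by blast+
  have one: "dist (1::'a) 0 = 1"
    using mult[of 1 1] by simp
  have "dist (of_nat (p ^ N) :: 'a) 0 = (1 / real p) ^ N" for N
    by (induction N) (simp_all add: one mult p)
  then show "\<forall>\<^sub>F N in sequentially. dist (of_nat (p ^ N) :: 'a) 0 \<le> dist ((1 / real p) ^ N) 0"
    by (simp add: dist_real_def)
  show "(\<lambda>N. (1 / real p) ^ N) \<longlonglongrightarrow> 0"
    using prime_gt_1_nat[OF \<open>prime p\<close>] by (intro LIMSEQ_realpow_zero) auto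
qed

definition boole_fps :: "'a::field_char_0 \<Rightarrow> 'a \<Rightarrow> 'a fps" where
  "boole_fps x l = 1 / (1 + fps_binomial l) * fps_binomial x"

lemma one_plus_fps_binomial_nth_0: "(1 + fps_binomial (l::'a::field_char_0)) $ 0 \<noteq> 0"
  by simp

lemma boole_fps_eq_inverse: "boole_fps x l = inverse (1 + fps_binomial l) * fps_binomial x"
  unfolding boole_fps_def by (simp add: fps_divide_unit)

text \<open>Expand the fraction \<open>(1 + t)^x / (1 + (1 + t)^(-l))\<close> by
  \<open>(1 + t)^l\<close>.\<close>

lemma boole_fps_uminus: "boole_fps x (- l) = boole_fps (x + l) l"
proof -
  have "(1 + fps_binomial (- l)) * fps_binomial l = 1 + fps_binomial l"
    by (simp add: distrib_right flip: fps_binomial_add_mult)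
  then have "inverse (1 + fps_binomial l) * fps_binomial (x + l) * (1 + fps_binomial (- l))
      = inverse (1 + fps_binomial l) * (1 + fps_binomial l) * fps_binomial x"
    by (simp add: fps_binomial_add_mult mult_ac)
  also have "\<dots> = fps_binomial x"
    by (simp add: inverse_mult_eq_1)
  also have "\<dots> = inverse (1 + fps_binomial (- l)) * fps_binomial x * (1 + fps_binomial (- l))"
    by (metis inverse_mult_eq_1 one_plus_fps_binomial_nth_0 mult.commute mult.left_commute mult_1_right)
  finally have "inverse (1 + fps_binomial l) * fps_binomial (x + l)
      = inverse (1 + fps_binomial (- l)) * fps_binomial x"
    using one_plus_fps_binomial_nth_0[of "- l"] by (metis fps_zero_nth mult_right_cancel)
  then show ?thesis by (simp add: boole_fps_eq_inverse)
qed

text \<open>A geometric sum with ratio \<open>?q\<close>: oddness of \<open>M\<close> turns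
  \<open>1 - ?q ^ M\<close> into the last factor, and dividing by \<open>1 - ?q\<close> leaves the
  Boole series for \<open>- l\<close>.\<close>

lemma alternating_sum_fps_binomial:
  assumes "odd M"
  shows "(\<Sum>a<M. (- 1) ^ a * fps_binomial (x - l * of_nat a))
    = boole_fps (x + l) l * (1 + fps_binomial (- l * of_nat M))"
proof -
  let ?q = "- fps_binomial (- l)"
  have q: "?q ^ a = (- 1) ^ a * fps_binomial (- l * of_nat a)" for a
    by (subst power_minus) (simp add: fps_binomial_power mult.commute)
  have "(- 1) ^ a * fps_binomial (x - l * of_nat a) = fps_binomial x * ?q ^ a" for a
    using fps_binomial_add_mult[of x "- l * of_nat a"] by (simp add: q mult_ac)
  then have "(1 + fps_binomial (- l)) * (\<Sum>a<M. (- 1) ^ a * fps_binomial (x - l * of_nat a))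
      = fps_binomial x * ((1 - ?q) * (\<Sum>a<M. ?q ^ a))"
    by (simp add: sum_distrib_left mult_ac)
  also have "\<dots> = fps_binomial x * (1 - ?q ^ M)"
    by (simp only: one_diff_power_eq)
  also have "\<dots> = fps_binomial x * (1 + fps_binomial (- l * of_nat M))"
    using assms by (simp add: q)
  finally have "inverse (1 + fps_binomial (- l)) * (1 + fps_binomial (- l)) *
        (\<Sum>a<M. (- 1) ^ a * fps_binomial (x - l * of_nat a))
      = boole_fps x (- l) * (1 + fps_binomial (- l * of_nat M))"
    by (simp add: boole_fps_eq_inverse mult.assoc)
  then show ?thesis by (simp add: inverse_mult_eq_1 boole_fps_uminus)
qed

lemma falling_factorial_eq_gbinomial:
  "falling_factorial z n = fact n * ((z::'a::field_char_0) gchoose n)"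
  by (simp add: falling_factorial_def gbinomial_prod_rev atLeast0LessThan)

lemma boole_poly_eq_nth: "boole_poly n x l = fact n * boole_fps x l $ n"
  by (simp add: boole_poly_def boole_fps_def)

lemma boole_poly_2nd_eq_nth:
  fixes l x :: "'a::{field_char_0,complete_space}"
  assumes H: "is_padic_complex_field p TYPE('a)" and "odd p"
  shows "boole_poly_2nd p n x l = fact n * boole_fps (x + l) l $ n"
proof -
  let ?G = "boole_fps (x + l) l"
  let ?S = "\<lambda>N. \<Sum>a = 0..p ^ N - 1. falling_factorial (- l * of_nat a + x) n * (- 1) ^ a"
  have S: "?S N = fact n * (\<Sum>i = 0..n. ?G $ i *
      ((1 :: 'a fps) $ (n - i) + ((- l * of_nat (p ^ N)) gchoose (n - i))))" for N
  proof -
    have sgn: "(- 1) ^ a * (z gchoose n) = ((- 1) ^ a * fps_binomial z) $ n" for a and z :: 'a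
      by (cases "even a") simp_all
    \<comment> \<open>The truncated subtraction loses nothing, since \<open>p ^ N\<close> is
      positive.\<close>
    have "{0..p ^ N - 1} = {..<p ^ N}"
      using \<open>odd p\<close> by (auto simp: Suc_le_eq less_Suc_eq_le le_diff_conv2 odd_pos)
    then have "?S N = fact n * (\<Sum>a<p ^ N. (- 1) ^ a * ((x - l * of_nat a) gchoose n))"
      by (simp add: falling_factorial_eq_gbinomial sum_distrib_left mult_ac)
    also have "(\<Sum>a<p ^ N. (- 1) ^ a * ((x - l * of_nat a) gchoose n))
        = (\<Sum>a<p ^ N. (- 1) ^ a * fps_binomial (x - l * of_nat a)) $ n"
      by (simp add: fps_sum_nth sgn)
    also have "(\<Sum>a<p ^ N. (- 1) ^ a * fps_binomial (x - l * of_nat a))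
        = ?G * (1 + fps_binomial (- l * of_nat (p ^ N)))"
      using \<open>odd p\<close> by (intro alternating_sum_fps_binomial) simp
    finally show ?thesis by (simp only: fps_mult_nth fps_add_nth fps_binomial_nth)
  qed
  \<comment> \<open>Each coefficient is a finite Cauchy product, so the limit is taken termwise. The
    unevaluated \<open>- l * 0\<close> has the shape that the limit rules produce.\<close>
  have "?S \<longlonglongrightarrow> fact n * (\<Sum>i = 0..n. ?G $ i * ((1 :: 'a fps) $ (n - i) + ((- l * 0) gchoose (n - i))))"
    unfolding S
    by (intro padic_tendsto_mult[OF H] padic_tendsto_sum[OF H] padic_tendsto_add[OF H]
        padic_tendsto_gbinomial[OF H] padic_power_tendsto_0[OF H] tendsto_const)
  also have "(\<Sum>i = 0..n. ?G $ i * ((1 :: 'a fps) $ (n - i) + ((- l * 0) gchoose (n - i))))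
      = (?G * (1 + fps_binomial 0)) $ n"
    by (simp only: fps_mult_nth fps_add_nth fps_binomial_nth mult_zero_right)
  also have "\<dots> = 2 * ?G $ n"
    by (simp only: fps_binomial_0 distrib_left mult_1_right fps_add_nth mult_2)
  \<comment> \<open>Convergence determines \<open>lim\<close>, and the 2 cancels the factor 1/2 of
    the definition.\<close>
  finally show ?thesis
    by (simp add: boole_poly_2nd_def fermionic_integral_def limI)
qed

text \<open>The series \<open>t / (1 - t)\<close>, in a form whose powers have coefficients given by \<^const>\<open>fps_binomial\<close>.\<close>

definition mobius_fps :: "'a::field_char_0 fps" where
  "mobius_fps = fps_X * (fps_binomial (- 1) oo - fps_X)"

lemma mobius_fps_nth_0 [simp]: "mobius_fps $ 0 = 0"
  by (simp add: mobius_fps_def)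

text \<open>By upper negation, \<open>(-m) gchoose k\<close> is \<open>(-1)^k\<close> times
  \<open>(m + k - 1) gchoose k\<close>. For \<open>k = n - m\<close> the upper entry is
  \<open>n - 1\<close>, and the sign cancels the one coming from \<open>- fps_X\<close>.\<close>

lemma mobius_fps_power_nth:
  assumes "n \<ge> 1" "m \<le> n"
  shows "(mobius_fps ^ m :: 'a::field_char_0 fps) $ n = of_nat (n - 1) gchoose (n - m)"
proof -
  have "(mobius_fps ^ m :: 'a fps) = fps_X ^ m * (fps_binomial (- of_nat m) oo - fps_X)"
    by (simp add: mobius_fps_def power_mult_distrib fps_compose_power fps_binomial_power)
  also have "\<dots> $ n = (- 1) ^ (n - m) * ((- of_nat m) gchoose (n - m))"
    using assms by (simp add: fps_X_power_mult_nth fps_compose_uminus')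
  also have "\<dots> = of_nat (n - 1) gchoose (n - m)"
    using assms by (simp add: gbinomial_minus of_nat_diff flip: mult.assoc power_add)
  finally show ?thesis .
qed

text \<open>Formally this is \<open>1 + t/(1 - t) = 1/(1 - t)\<close> raised to the power
  \<open>a\<close>. For arbitrary \<open>a\<close> it is checked coefficientwise, by Vandermonde
  convolution and upper negation.\<close>

lemma fps_binomial_compose_mobius:
  "fps_binomial a oo mobius_fps = fps_binomial (- a) oo - fps_X"
proof (rule fps_ext)
  fix n
  show "(fps_binomial a oo mobius_fps) $ n = (fps_binomial (- a) oo - fps_X) $ n"
  proof (cases "n = 0")
    case False
    then have "(fps_binomial a oo mobius_fps) $ n
        = (\<Sum>m = 0..n. (a gchoose m) * (of_nat (n - 1) gchoose (n - m)))"
      by (auto simp: fps_compose_nth mobius_fps_power_nth intro!: sum.cong)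
    also have "\<dots> = (a + of_nat n - 1) gchoose n"
      using False by (simp add: gbinomial_Vandermonde of_nat_diff add_diff_eq)
    also have "\<dots> = (fps_binomial (- a) oo - fps_X) $ n"
      by (simp add: fps_compose_uminus' gbinomial_minus flip: mult.assoc power_add)
    finally show ?thesis .
  qed simp
qed

text \<open>Composition respects products and inverses, so both exponents of the fraction are
  negated; \<open>boole_fps_uminus\<close> then restores \<open>l\<close> at the cost of a
  shift.\<close>

lemma boole_fps_compose_mobius:
  "boole_fps x l oo mobius_fps = boole_fps (- x + l) l oo - fps_X"
proof -
  have "boole_fps x l oo mobius_fps = boole_fps (- x) (- l) oo - fps_X"
    by (simp add: boole_fps_eq_inverse fps_compose_mult_distrib fps_inverse_compose
        fps_compose_add_distrib fps_binomial_compose_mobius)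
  then show ?thesis by (simp add: boole_fps_uminus)
qed

lemma boole_fps_nth_reflect:
  assumes "n \<ge> 1"
  shows "(- 1) ^ n * boole_fps (- x + l) l $ n
    = (\<Sum>m = 1..n. of_nat ((n - 1) choose (m - 1)) * boole_fps x l $ m)"
proof -
  have "(- 1) ^ n * boole_fps (- x + l) l $ n = (boole_fps x l oo mobius_fps) $ n"
    by (simp add: boole_fps_compose_mobius fps_compose_uminus')
  also have "\<dots> = (\<Sum>m = 0..n. boole_fps x l $ m * of_nat ((n - 1) choose (n - m)))"
    using assms by (simp add: fps_compose_nth mobius_fps_power_nth binomial_gbinomial)
  \<comment> \<open>The term for \<open>m = 0\<close> drops out, since
    \<open>(n - 1) choose n\<close> is 0.\<close>
  also have "\<dots> = (\<Sum>m = 1..n. boole_fps x l $ m * of_nat ((n - 1) choose (n - m)))"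
    using assms by (simp add: sum.atLeast_Suc_atMost binomial_eq_0)
  also have "\<dots> = (\<Sum>m = 1..n. of_nat ((n - 1) choose (m - 1)) * boole_fps x l $ m)"
  proof (rule sum.cong[OF refl])
    fix m assume "m \<in> {1..n}"
    then have "(n - 1) choose (n - m) = (n - 1) choose (m - 1)"
      using binomial_symmetric[of "m - 1" "n - 1"] by auto
    then show "boole_fps x l $ m * of_nat ((n - 1) choose (n - m))
        = of_nat ((n - 1) choose (m - 1)) * boole_fps x l $ m" by simp
  qed
  finally show ?thesis .
qed

theorem theorem6:
  fixes p n :: nat and l x :: "'a::{field_char_0,complete_space}"
  assumes "prime p" and "odd p"
    and "is_padic_complex_field p TYPE('a)"
    and "l \<in> padic_integers"
    and "n \<ge> 1"
  shows "(-1) ^ n * boole_poly n x l / fact n =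
           (\<Sum>m = 1..n. of_nat ((n - 1) choose (m - 1)) * boole_poly_2nd p m (- x) l / fact m)
       \<and> (-1) ^ n * boole_poly_2nd p n x l / fact n =
           (\<Sum>m = 1..n. of_nat ((n - 1) choose (m - 1)) * boole_poly m (- x) l / fact m)"
  \<comment> \<open>The series at \<open>- x + l\<close> generates the second kind at
    \<open>- x\<close>, and its reflection is the series at \<open>x\<close>. Starting from
    \<open>- x\<close> instead exchanges the two kinds.\<close>
  using boole_fps_nth_reflect[OF \<open>n \<ge> 1\<close>, of "- x + l" l] boole_fps_nth_reflect[OF \<open>n \<ge> 1\<close>, of "- x" l]
  by (simp add: boole_poly_eq_nth boole_poly_2nd_eq_nth[OF assms(3,2)])

end
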